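(* Let $\Sigma$ be a finite alphabet and let $X\subset\Sigma^{\mathbb Z}$ be a subshift with left shift $S_\Sigma$. The following are equivalent: (i) $(X,S_\Sigma^{-1})$ has property (D), i.e. the time-reversed form of property (D) holds for $X$: for every $\sigma\in\Sigma$ and every $b\in\Gamma^+(\sigma)$ there exists a word $a\in\Gamma^+(b)$ such that $\sigma\in\omega^-_1(ba)$. (ii) $X$ is $\lambda$-synchronizing. (iii) For every $b\in\mathcal L(X)$ there exists an $a\in\mathcal L(X)$ such that $b\in\omega^-(a)$.
   Context: $S_\Sigma$ is the left shift on $\Sigma^{\mathbb Z}$, $S_\Sigma((x_i)_{i\in\mathbb Z})=(x_{i+1})_{i\in\mathbb Z}$. A subshift is a closed shift-invariant subset $X\subset\Sigma^{\mathbb Z}$. A finite (nonempty) word over $\Sigma$ is admissible for $X$ if it appears somewhere in a point of $X$; $\mathcal L(X)$ is the set of admissible words and $\mathcal L_n(X)$ the set of admissible words of length $n\in\mathbb N$. For $a\in\mathcal L(X)$ put $\Gamma^+(a)=\{c\in\mathcal L(X): ac\in\mathcal L(X)\}$, $\Gamma^-(a)=\{c\in\mathcal L(X): ca\in\mathcal L(X)\}$, $\Gamma^\pm_n(a)=\Gamma^\pm(a)\cap\mathcal L_n(X)$. Put $\omega^+_n(a)=\bigcap_{c\in\Gamma^-(a)}\{b\in\mathcal L_n(X): cab\in\mathcal L(X)\}$ and, time-symmetrically, $\omega^-_n(a)=\bigcap_{c\in\Gamma^+(a)}\{b\in\mathcal L_n(X): bac\in\mathcal L(X)\}$; $\omega^-(a)=\bigcup_{n\in\mathbb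 N}\omega^-_n(a)$. For a symbol $\sigma\in\Sigma$ that is not admissible for $X$, put $\Gamma^\pm(\sigma)=\emptyset$. A subshift $X$ has property (D) if for every $\sigma\in\Sigma$ and $b\in\Gamma^-(\sigma)$ there exists a word $a\in\Gamma^-(b)$ such that $\sigma\in\omega^+_1(ab)$. Property (D) of $(X,S_\Sigma^{-1})$ means this property with the direction of time (reading order of words) reversed. For $l\in\mathbb N$, a word $v\in\mathcal L(X)$ is $l$-synchronizing if $\Gamma^-_l(v)\subset\omega^-_l(v)$; $\mathcal S_l(X)$ is the set of $l$-synchronizing words. $X$ is $\lambda$-synchronizing if for every $w\in\mathcal L(X)$ and $k\in\mathbb N$ there is a word $v\in\mathcal S_k(X)\cap\Gamma^+(w)$. *)

theory Defs
  imports "HOL-Analysis.Analysis"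
begin

definition shift :: "(int \<Rightarrow> 'a) \<Rightarrow> (int \<Rightarrow> 'a)" where
  "shift x = (\<lambda>i. x (i + 1))"

abbreviation full_shift :: "'a set \<Rightarrow> (int \<Rightarrow> 'a) topology" where
  "full_shift \<Sigma> \<equiv> product_topology (\<lambda>_::int. discrete_topology \<Sigma>) UNIV"

definition subshift :: "'a set \<Rightarrow> (int \<Rightarrow> 'a) set \<Rightarrow> bool" where
  "subshift \<Sigma> X \<longleftrightarrow> closedin (full_shift \<Sigma>) X \<and> shift ` X = X"

text \<open>Admissible words are nonempty, so there is no admissible word of length 0; accordingly
  the word lengths \<open>n\<close> below are meant to range over the positive integers.\<close>

definition lang :: "(int \<Rightarrow> 'a) set \<Rightarrow> 'a list set" where
  "lang X = {w. w \<noteq> [] \<and> (\<exists>x\<in>X. \<exists>i::int. \<forall>j<length w. w ! j = x (i + int j))}"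

definition lang_n :: "(int \<Rightarrow> 'a) set \<Rightarrow> nat \<Rightarrow> 'a list set" where
  "lang_n X n = {w \<in> lang X. length w = n}"

text \<open>A symbol \<open>\<sigma>\<close> is treated as the word \<open>[\<sigma>]\<close>. Since factors of admissible words are
  admissible, both sets below are empty for inadmissible \<open>a\<close>
  (lemma \<open>Gamma_inadmissible\<close>).\<close>

definition Gamma_plus :: "(int \<Rightarrow> 'a) set \<Rightarrow> 'a list \<Rightarrow> 'a list set" where
  "Gamma_plus X a = {c \<in> lang X. a @ c \<in> lang X}"

definition Gamma_minus :: "(int \<Rightarrow> 'a) set \<Rightarrow> 'a list \<Rightarrow> 'a list set" where
  "Gamma_minus X a = {c \<in> lang X. c @ a \<in> lang X}"

definition Gamma_minus_n :: "(int \<Rightarrow> 'a) set \<Rightarrow> nat \<Rightarrow> 'a list \<Rightarrow> 'a list set" where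
  "Gamma_minus_n X n a = Gamma_minus X a \<inter> lang_n X n"

definition omega_plus_n :: "(int \<Rightarrow> 'a) set \<Rightarrow> nat \<Rightarrow> 'a list \<Rightarrow> 'a list set" where
  "omega_plus_n X n a = (\<Inter>c \<in> Gamma_minus X a. {b \<in> lang_n X n. c @ a @ b \<in> lang X})"

definition omega_minus_n :: "(int \<Rightarrow> 'a) set \<Rightarrow> nat \<Rightarrow> 'a list \<Rightarrow> 'a list set" where
  "omega_minus_n X n a = (\<Inter>c \<in> Gamma_plus X a. {b \<in> lang_n X n. b @ a @ c \<in> lang X})"

definition omega_minus :: "(int \<Rightarrow> 'a) set \<Rightarrow> 'a list \<Rightarrow> 'a list set" where
  "omega_minus X a = (\<Union>n\<in>{1..}. omega_minus_n X n a)"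

definition property_D :: "'a set \<Rightarrow> (int \<Rightarrow> 'a) set \<Rightarrow> bool" where
  "property_D \<Sigma> X \<longleftrightarrow>
    (\<forall>\<sigma>\<in>\<Sigma>. \<forall>b\<in>Gamma_minus X [\<sigma>]. \<exists>a\<in>Gamma_minus X b. [\<sigma>] \<in> omega_plus_n X 1 (a @ b))"

text \<open>Property (D) of the system with the inverse shift, i.e. with the reading order of words
  reversed; lemma \<open>property_D_time_reversal\<close> confirms that it is property (D) of the
  reflected subshift.\<close>

definition property_D_inverse :: "'a set \<Rightarrow> (int \<Rightarrow> 'a) set \<Rightarrow> bool" where
  "property_D_inverse \<Sigma> X \<longleftrightarrow>
    (\<forall>\<sigma>\<in>\<Sigma>. \<forall>b\<in>Gamma_plus X [\<sigma>]. \<exists>a\<in>Gamma_plus X b. [\<sigma>] \<in> omega_minus_n X 1 (b @ a))"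

definition synchronizing_words :: "(int \<Rightarrow> 'a) set \<Rightarrow> nat \<Rightarrow> 'a list set" where
  "synchronizing_words X l = {v \<in> lang X. Gamma_minus_n X l v \<subseteq> omega_minus_n X l v}"

definition lambda_synchronizing :: "(int \<Rightarrow> 'a) set \<Rightarrow> bool" where
  "lambda_synchronizing X \<longleftrightarrow>
    (\<forall>w\<in>lang X. \<forall>k\<ge>1. \<exists>v. v \<in> synchronizing_words X k \<inter> Gamma_plus X w)"

lemma lang_factor:
  assumes "u @ v @ w \<in> lang X" "v \<noteq> []"
  shows "v \<in> lang X"
proof -
  obtain x i where x: "x \<in> X"
    and eq: "\<And>j. j < length (u @ v @ w) \<Longrightarrow> (u @ v @ w) ! j = x (i + int j)"
    using assms(1) unfolding lang_def by blast
  have "v ! j = x ((i + int (length u)) + int j)" if "j < length v" for j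
    using eq[of "length u + j"] that by (simp add: nth_append add.assoc)
  then show ?thesis
    using x assms(2) unfolding lang_def by blast
qed

lemma Gamma_inadmissible:
  assumes "a \<noteq> []" "a \<notin> lang X"
  shows "Gamma_plus X a = {}" "Gamma_minus X a = {}"
  using assms lang_factor[of "[]" a _ X] lang_factor[of _ a "[]" X]
  by (auto simp: Gamma_plus_def Gamma_minus_def)

definition time_reversal :: "(int \<Rightarrow> 'a) set \<Rightarrow> (int \<Rightarrow> 'a) set" where
  "time_reversal X = (\<lambda>x i. x (- i)) ` X"

lemma time_reversal_involution: "time_reversal (time_reversal X) = X"
  by (simp add: time_reversal_def image_image)

lemma rev_in_lang:
  assumes "w \<in> lang (time_reversal X)"
  shows "rev w \<in> lang X"
proof -
  obtain x i where x: "x \<in> X" and ne: "w \<noteq> []"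
    and eq: "\<And>j. j < length w \<Longrightarrow> w ! j = x (- (i + int j))"
    using assms unfolding lang_def time_reversal_def by auto
  have "rev w ! j = x (- (i + int (length w) - 1) + int j)" if "j < length w" for j
  proof -
    have "rev w ! j = x (- (i + int (length w - Suc j)))"
      using that eq[of "length w - Suc j"] by (simp only: rev_nth)
    moreover have "- (i + int (length w - Suc j)) = - (i + int (length w) - 1) + int j"
      using that by (simp add: of_nat_diff)
    ultimately show ?thesis
      by (simp only:)
  qed
  then show ?thesis
    using x ne unfolding lang_def by (auto intro!: bexI[of _ x] exI)
qed

lemma lang_time_reversal: "w \<in> lang (time_reversal X) \<longleftrightarrow> rev w \<in> lang X"
  using rev_in_lang[of w X] rev_in_lang[of "rev w" "time_reversal X"]
  by (auto simp: time_reversal_involution)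

lemma lang_n_time_reversal: "w \<in> lang_n (time_reversal X) n \<longleftrightarrow> rev w \<in> lang_n X n"
  by (simp add: lang_n_def lang_time_reversal)

lemma Gamma_minus_time_reversal:
  "c \<in> Gamma_minus (time_reversal X) a \<longleftrightarrow> rev c \<in> Gamma_plus X (rev a)"
  by (simp add: Gamma_minus_def Gamma_plus_def lang_time_reversal)

lemma all_rev: "(\<forall>w. P (rev w)) \<longleftrightarrow> (\<forall>w. P w)"
  by (metis rev_rev_ident)

lemma ex_rev: "(\<exists>w. P (rev w)) \<longleftrightarrow> (\<exists>w. P w)"
  by (metis rev_rev_ident)

lemma omega_plus_n_time_reversal:
  "b \<in> omega_plus_n (time_reversal X) n a \<longleftrightarrow> rev b \<in> omega_minus_n X n (rev a)"
proof -
  have "b \<in> omega_plus_n (time_reversal X) n a \<longleftrightarrow>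
    (\<forall>c. rev c \<in> Gamma_plus X (rev a) \<longrightarrow>
      rev b \<in> lang_n X n \<and> rev b @ rev a @ rev c \<in> lang X)"
    by (auto simp: omega_plus_n_def Gamma_minus_time_reversal lang_n_time_reversal
        lang_time_reversal)
  also have "\<dots> \<longleftrightarrow> rev b \<in> omega_minus_n X n (rev a)"
    by (subst all_rev) (auto simp: omega_minus_n_def)
  finally show ?thesis .
qed

lemma property_D_time_reversal:
  "property_D \<Sigma> (time_reversal X) \<longleftrightarrow> property_D_inverse \<Sigma> X"
proof -
  have "(\<exists>a\<in>Gamma_minus (time_reversal X) b.
          [\<sigma>] \<in> omega_plus_n (time_reversal X) 1 (a @ b)) \<longleftrightarrow>
        (\<exists>a\<in>Gamma_plus X (rev b). [\<sigma>] \<in> omega_minus_n X 1 (rev b @ a))" for b \<sigma>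
    using ex_rev[of "\<lambda>a. a \<in> Gamma_plus X (rev b) \<and> [\<sigma>] \<in> omega_minus_n X 1 (rev b @ a)"]
    by (simp add: Bex_def Gamma_minus_time_reversal omega_plus_n_time_reversal)
  then have "property_D \<Sigma> (time_reversal X) \<longleftrightarrow>
    (\<forall>\<sigma>\<in>\<Sigma>. \<forall>b. rev b \<in> Gamma_plus X [\<sigma>] \<longrightarrow>
      (\<exists>a\<in>Gamma_plus X (rev b). [\<sigma>] \<in> omega_minus_n X 1 (rev b @ a)))"
    by (simp add: property_D_def Ball_def[of "Gamma_minus _ _"] Gamma_minus_time_reversal)
  also have "\<dots> \<longleftrightarrow> property_D_inverse \<Sigma> X"
    unfolding property_D_inverse_def by (subst all_rev) auto
  finally show ?thesis .
qed

end

theory Submission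
  imports Defs
begin

text \<open>Call \<open>b\<close> a free prefix of \<open>a\<close> if \<open>b a c\<close> is admissible whenever \<open>a c\<close> is, so that
  \<open>\<omega>\<^sup>-(a)\<close> consists of the free prefixes of \<open>a\<close>. This relation survives every admissible extension
  of \<open>a\<close> to the right. (i) \<open>\<Longrightarrow>\<close> (iii): apply (D) to the symbols of \<open>b\<close> one after the other, each
  time extending \<open>a\<close>. (iii) \<open>\<Longrightarrow>\<close> (ii): among the words \<open>v\<close> that have \<open>w\<close> as a free prefix, one with
  the fewest predecessors of length \<open>k\<close> is \<open>k\<close>-synchronizing, since otherwise an extension of \<open>v\<close>
  would lose a predecessor. (ii) \<open>\<Longrightarrow>\<close> (i): apply (ii) to \<open>w = \<sigma> b\<close> with \<open>k\<close> the length of \<open>w\<close>.\<close>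

lemma lang_appendD1: "u @ v \<in> lang X \<Longrightarrow> u \<noteq> [] \<Longrightarrow> u \<in> lang X"
  using lang_factor[of "[]" u v X] by simp

lemma lang_appendD2: "u @ v \<in> lang X \<Longrightarrow> v \<noteq> [] \<Longrightarrow> v \<in> lang X"
  using lang_factor[of u v "[]" X] by simp

lemma lang_nonempty: "w \<in> lang X \<Longrightarrow> w \<noteq> []"
  by (simp add: lang_def)

lemma lang_extend_right:
  assumes "w \<in> lang X"
  obtains \<tau> where "w @ [\<tau>] \<in> lang X"
proof -
  obtain x i where x: "x \<in> X" and eq: "\<And>j. j < length w \<Longrightarrow> w ! j = x (i + int j)"
    using assms unfolding lang_def by blast
  have "(w @ [x (i + int (length w))]) ! j = x (i + int j)" if "j < length w + 1" for j
    using that eq[of j] by (cases "j = length w") (auto simp: nth_append)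
  then have "w @ [x (i + int (length w))] \<in> lang X"
    using x unfolding lang_def by auto
  then show thesis by (rule that)
qed

lemma set_lang_subset:
  assumes "subshift \<Sigma> X" "w \<in> lang X"
  shows "set w \<subseteq> \<Sigma>"
proof -
  have "X \<subseteq> topspace (full_shift \<Sigma>)"
    using assms(1) unfolding subshift_def by (blast dest: closedin_subset)
  then have "x i \<in> \<Sigma>" if "x \<in> X" for x i
    using that by (auto simp: PiE_def Pi_def)
  then show ?thesis
    using assms(2) unfolding lang_def by (fastforce simp: in_set_conv_nth)
qed

text \<open>This is where finiteness of the alphabet enters: the predecessor sets of a given length
  can then be compared by cardinality.\<close>

lemma finite_lang_n:
  assumes "finite \<Sigma>" "subshift \<Sigma> X"
  shows "finite (lang_n X n)"
  by (rule finite_subset[OF _ finite_lists_length_eq[OF assms(1), of n]])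
    (use set_lang_subset[OF assms(2)] in \<open>auto simp: lang_n_def\<close>)

text \<open>The empty \<open>c\<close> is allowed, unlike in \<open>Gamma_plus\<close>, and no
  length is fixed, so extension and composition need no side conditions.\<close>

definition free_prefix :: "(int \<Rightarrow> 'a) set \<Rightarrow> 'a list \<Rightarrow> 'a list \<Rightarrow> bool" where
  "free_prefix X b a \<longleftrightarrow> (\<forall>c. a @ c \<in> lang X \<longrightarrow> b @ a @ c \<in> lang X)"

lemma free_prefixD: "free_prefix X b a \<Longrightarrow> a \<in> lang X \<Longrightarrow> b @ a \<in> lang X"
  unfolding free_prefix_def by (metis append_Nil2)

lemma free_prefix_extend: "free_prefix X b a \<Longrightarrow> free_prefix X b (a @ c)"
  unfolding free_prefix_def by simp

lemma free_prefix_append: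
  "free_prefix X u (v @ a) \<Longrightarrow> free_prefix X v a \<Longrightarrow> free_prefix X (u @ v) a"
  unfolding free_prefix_def by simp

text \<open>An admissible \<open>v @ a @ c\<close> has the admissible suffix \<open>a @ c\<close>,
  nonempty because \<open>a\<close> is.\<close>

lemma free_prefix_shift:
  assumes "free_prefix X (u @ v) a" "a \<noteq> []"
  shows "free_prefix X u (v @ a)"
  using assms lang_appendD2[of v "a @ _" X] unfolding free_prefix_def by auto

text \<open>For inadmissible \<open>a\<close> the intersection defining \<open>\<omega>\<^sup>-\<^sub>n(a)\<close> has an empty index set, so it is
  the set of all words.\<close>

lemma omega_minus_n_iff:
  assumes "a \<in> lang X" "n \<ge> 1"
  shows "b \<in> omega_minus_n X n a \<longleftrightarrow> length b = n \<and> free_prefix X b a"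
proof
  assume b: "b \<in> omega_minus_n X n a"
  \<comment> \<open>\<open>Gamma_plus\<close> contains no empty word, so the case
    \<open>c = []\<close> is reached by cutting \<open>\<tau>\<close> off
    \<open>b @ a @ [\<tau>]\<close>.\<close>
  obtain \<tau> where \<tau>: "a @ [\<tau>] \<in> lang X"
    using lang_extend_right[OF assms(1)] .
  have G: "b \<in> lang_n X n \<and> b @ a @ c \<in> lang X" if "a @ c \<in> lang X" "c \<noteq> []" for c
    using b that lang_appendD2[OF that] by (auto simp: omega_minus_n_def Gamma_plus_def)
  have "b @ a \<in> lang X"
    using G[OF \<tau>] lang_appendD1[of "b @ a" "[\<tau>]" X] lang_nonempty[OF assms(1)] by simp
  then have "b @ a @ c \<in> lang X" if "a @ c \<in> lang X" for c
    using G[OF that] by (cases "c = []") auto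
  then show "length b = n \<and> free_prefix X b a"
    using G[OF \<tau>] by (auto simp: free_prefix_def lang_n_def)
next
  assume b: "length b = n \<and> free_prefix X b a"
  then have "b \<in> lang X"
    using free_prefixD[of X b a] lang_appendD1[of b a X] assms by fastforce
  with b show "b \<in> omega_minus_n X n a"
    by (auto simp: omega_minus_n_def Gamma_plus_def free_prefix_def lang_n_def)
qed

lemma omega_minus_iff:
  assumes "a \<in> lang X"
  shows "b \<in> omega_minus X a \<longleftrightarrow> b \<noteq> [] \<and> free_prefix X b a"
  using omega_minus_n_iff[OF assms] by (fastforce simp: omega_minus_def Suc_le_eq)

text \<open>Each use of (D) frees one symbol at the cost of a longer right context, so the induction
  on \<open>b\<close> leaves \<open>c\<close> arbitrary.\<close>

lemma property_D_inverse_free_prefix: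
  assumes D: "property_D_inverse \<Sigma> X" and sub: "subshift \<Sigma> X"
    and "b @ c \<in> lang X" "c \<noteq> []"
  shows "\<exists>d. b @ c @ d \<in> lang X \<and> free_prefix X b (c @ d)"
  using assms(3,4)
proof (induction b arbitrary: c)
  case Nil
  then show ?case
    by (intro exI[of _ "[]"]) (simp add: free_prefix_def)
next
  case (Cons \<sigma> b)
  have "[\<sigma>] \<in> lang X" and bc: "b @ c \<in> lang X"
    using Cons.prems lang_appendD1[of "[\<sigma>]" "b @ c" X] lang_appendD2[of "[\<sigma>]" "b @ c" X] by auto
  then have "\<sigma> \<in> \<Sigma>" and "b @ c \<in> Gamma_plus X [\<sigma>]"
    using set_lang_subset[OF sub, of "[\<sigma>]"] Cons.prems by (auto simp: Gamma_plus_def)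
  then obtain a where a: "a \<in> Gamma_plus X (b @ c)" "[\<sigma>] \<in> omega_minus_n X 1 ((b @ c) @ a)"
    using D unfolding property_D_inverse_def by blast
  then have bca: "b @ c @ a \<in> lang X" and \<sigma>: "free_prefix X [\<sigma>] (b @ c @ a)"
    using omega_minus_n_iff[of "(b @ c) @ a" X 1] by (auto simp: Gamma_plus_def)
  \<comment> \<open>The leftmost symbol is already free; freeing the rest over \<open>c @ a\<close>
    only adds \<open>d\<close> on the right, which \<open>\<sigma>\<close> tolerates.\<close>
  obtain d where d: "b @ (c @ a) @ d \<in> lang X" "free_prefix X b ((c @ a) @ d)"
    using Cons.IH[of "c @ a"] bca Cons.prems by auto
  have \<sigma>': "free_prefix X [\<sigma>] (b @ c @ a @ d)"
    using free_prefix_extend[OF \<sigma>, of d] by simp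
  have "\<sigma> # b @ c @ a @ d \<in> lang X"
    using free_prefixD[OF \<sigma>'] d by simp
  moreover have "free_prefix X (\<sigma> # b) (c @ a @ d)"
    using free_prefix_append[of X "[\<sigma>]" b "c @ a @ d"] \<sigma>' d by simp
  ultimately show ?case
    by (intro exI[of _ "a @ d"]) simp
qed

lemma property_D_inverse_imp_omega_minus:
  assumes "property_D_inverse \<Sigma> X" "subshift \<Sigma> X" "b \<in> lang X"
  shows "\<exists>a\<in>lang X. b \<in> omega_minus X a"
proof -
  \<comment> \<open>One symbol following \<open>b\<close> serves as the nonempty initial
    context.\<close>
  obtain \<tau> where "b @ [\<tau>] \<in> lang X"
    using lang_extend_right[OF assms(3)] .
  then obtain d where d: "b @ [\<tau>] @ d \<in> lang X" "free_prefix X b ([\<tau>] @ d)"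
    using property_D_inverse_free_prefix[OF assms(1,2)] by blast
  then have "[\<tau>] @ d \<in> lang X"
    using lang_appendD2 by blast
  then show ?thesis
    using d omega_minus_iff lang_nonempty[OF assms(3)] by blast
qed

lemma omega_minus_imp_lambda_synchronizing:
  assumes "finite \<Sigma>" "subshift \<Sigma> X" and iii: "\<forall>b\<in>lang X. \<exists>a\<in>lang X. b \<in> omega_minus X a"
  shows "lambda_synchronizing X"
  unfolding lambda_synchronizing_def
proof (intro ballI allI impI)
  fix w k assume w: "w \<in> lang X" and k: "k \<ge> (1::nat)"
  obtain a where "a \<in> lang X \<and> free_prefix X w a"
    using iii w omega_minus_iff by blast
  then obtain v where v: "v \<in> lang X" "free_prefix X w v"
    and least: "\<And>u. u \<in> lang X \<and> free_prefix X w u \<Longrightarrow>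
      card (Gamma_minus_n X k v) \<le> card (Gamma_minus_n X k u)"
    using ex_has_least_nat[of "\<lambda>a. a \<in> lang X \<and> free_prefix X w a" a
        "\<lambda>a. card (Gamma_minus_n X k a)"] by blast
  have "free_prefix X u v" if u: "u \<in> Gamma_minus_n X k v" for u
    unfolding free_prefix_def
  proof (intro allI impI, rule ccontr)
    fix c assume vc: "v @ c \<in> lang X" and uvc: "u @ v @ c \<notin> lang X"
    \<comment> \<open>Passing to \<open>v @ c\<close> loses the predecessor \<open>u\<close> and
      gains none, while \<open>w\<close> stays a free prefix.\<close>
    have "Gamma_minus_n X k (v @ c) \<subseteq> Gamma_minus_n X k v"
      using lang_appendD1[of "_ @ v" c X] lang_nonempty[OF v(1)]
      by (auto simp: Gamma_minus_n_def Gamma_minus_def)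
    moreover have "u \<notin> Gamma_minus_n X k (v @ c)"
      using uvc by (simp add: Gamma_minus_n_def Gamma_minus_def)
    moreover have "finite (Gamma_minus_n X k v)"
      using finite_lang_n[OF assms(1,2)] by (simp add: Gamma_minus_n_def)
    ultimately have "card (Gamma_minus_n X k (v @ c)) < card (Gamma_minus_n X k v)"
      using u by (intro psubset_card_mono) auto
    then show False
      using least[of "v @ c"] vc free_prefix_extend[OF v(2)] by fastforce
  qed
  then have "Gamma_minus_n X k v \<subseteq> omega_minus_n X k v"
    using omega_minus_n_iff[OF v(1) k] by (auto simp: Gamma_minus_n_def lang_n_def)
  then have "v \<in> synchronizing_words X k \<inter> Gamma_plus X w"
    using v free_prefixD by (auto simp: synchronizing_words_def Gamma_plus_def)
  then show "\<exists>v. v \<in> synchronizing_words X k \<inter> Gamma_plus X w" ..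
qed

lemma lambda_synchronizing_imp_property_D_inverse:
  assumes "lambda_synchronizing X"
  shows "property_D_inverse \<Sigma> X"
  unfolding property_D_inverse_def
proof (intro ballI)
  fix \<sigma> b assume "b \<in> Gamma_plus X [\<sigma>]"
  then have w: "\<sigma> # b \<in> lang X" and b: "b \<noteq> []"
    by (auto simp: Gamma_plus_def dest: lang_nonempty)
  \<comment> \<open>With this length \<open>\<sigma> # b\<close> is itself one of the predecessors
    of \<open>v\<close> that synchronization controls.\<close>
  define k where "k = length (\<sigma> # b)"
  have k: "k \<ge> 1" by (simp add: k_def)
  obtain v where v: "v \<in> synchronizing_words X k" "v \<in> Gamma_plus X (\<sigma> # b)"
    using assms w k unfolding lambda_synchronizing_def by blast
  then have vL: "v \<in> lang X" and wv: "[\<sigma>] @ b @ v \<in> lang X"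
    by (auto simp: Gamma_plus_def)
  have "\<sigma> # b \<in> Gamma_minus_n X k v"
    using w wv by (simp add: Gamma_minus_n_def Gamma_minus_def lang_n_def k_def)
  then have "\<sigma> # b \<in> omega_minus_n X k v"
    using v(1) by (auto simp: synchronizing_words_def)
  then have "free_prefix X ([\<sigma>] @ b) v"
    using omega_minus_n_iff[OF vL k] by simp
  then have "free_prefix X [\<sigma>] (b @ v)"
    using free_prefix_shift lang_nonempty[OF vL] by blast
  moreover have bv: "b @ v \<in> lang X"
    using lang_appendD2[OF wv] b by simp
  ultimately have "[\<sigma>] \<in> omega_minus_n X 1 (b @ v)"
    using omega_minus_n_iff[of "b @ v" X 1] by simp
  moreover have "v \<in> Gamma_plus X b"
    using vL bv by (simp add: Gamma_plus_def)
  ultimately show "\<exists>a\<in>Gamma_plus X b. [\<sigma>] \<in> omega_minus_n X 1 (b @ a)" by blast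
qed

theorem lemma2p1:
  fixes \<Sigma> :: "'a set" and X :: "(int \<Rightarrow> 'a) set"
  assumes "finite \<Sigma>" and "subshift \<Sigma> X"
  shows "(property_D_inverse \<Sigma> X \<longleftrightarrow> lambda_synchronizing X) \<and>
    (lambda_synchronizing X \<longleftrightarrow> (\<forall>b\<in>lang X. \<exists>a\<in>lang X. b \<in> omega_minus X a))"
  using property_D_inverse_imp_omega_minus[OF _ assms(2)]
    omega_minus_imp_lambda_synchronizing[OF assms]
    lambda_synchronizing_imp_property_D_inverse[of X \<Sigma>] by blast

end
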